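(* Let $K_1,K_2\in\mathbb{R}\setminus\{0\}$ and consider the system $$\left\{\begin{aligned} \dot{\theta}_1&=\tfrac{K_2}{3}\sin(\theta_3-\theta_1)+\tfrac{K_1}{3}\sin(\theta_2-\theta_1)\\ \dot{\theta}_2&=\tfrac{K_2}{3}\sin(\theta_3-\theta_2)+\tfrac{K_1}{3}\sin(\theta_1-\theta_2)\\ \dot{\theta}_3&=\tfrac{K_2}{3}\sin(\theta_1-\theta_3)+\tfrac{K_2}{3}\sin(\theta_2-\theta_3) \end{aligned}\right.$$ with its critical points $$\Theta^*_1=(0,\pi,0),\quad \Theta^*_2=(0,\pi,\pi),\quad \Theta^*_3=(0,0,0),\quad \Theta^*_4=(0,0,\pi),$$ and, existing only under the condition $\left|\frac{K_2}{2K_1}\right|\le 1$, $$\Theta^*_5=\left(0,2\arccos\left(-\tfrac{K_2}{2K_1}\right),\arccos\left(-\tfrac{K_2}{2K_1}\right)\right),\quad \Theta^*_6=\left(0,2\pi-2\arccos\left(-\tfrac{K_2}{2K_1}\right),2\pi-\arccos\left(-\tfrac{K_2}{2K_1}\right)\right).$$ The linear stability of these critical points is as follows. (1) $\Theta^*_1$ and $\Theta^*_2$ are unstable for any $K_1,K_2\in\mathbb{R}\setminus\{0\}$. (2) If $K_2>0$ and $2K_1+K_2>0$, then $\Theta^*_3$ is stable and all the other (existing) critical points in the list are unstable. (3) If $K_2<0$ and $2K_1-K_2>0$, then $\Theta^*_4$ is stable and all the other (existing) critical points in the list are unstable. (4) If $2K_1+K_2<0$ and $2K_1-K_2<0$,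 then $\Theta^*_5$ and $\Theta^*_6$ are stable and the four others $\Theta^*_1,\Theta^*_2,\Theta^*_3,\Theta^*_4$ are unstable.
   Context: A critical point is a zero of the right-hand side of the system. Because of the shift invariance $\Theta\mapsto\Theta+c(1,1,1)$, the Jacobian matrix $J_{\Theta^*}$ of the right-hand side at a critical point $\Theta^*$ (a real symmetric $3\times 3$ matrix with zero row sums) always has $0$ as an eigenvalue, with eigenvector $(1,1,1)^{\mathrm T}$. A critical point $\Theta^*$ is (linearly) stable if the remaining two eigenvalues of $J_{\Theta^*}$ (counted with multiplicity) are negative, and (linearly) unstable if $J_{\Theta^*}$ has a positive eigenvalue. Here $\arccos:[-1,1]\to[0,\pi]$. *)

theory Defs
  imports "HOL-Analysis.Analysis" "HOL-Computational_Algebra.Computational_Algebra"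
begin

definition eigenvalue :: "real^'n^'n \<Rightarrow> real \<Rightarrow> bool" where
  "eigenvalue A l \<longleftrightarrow> (\<exists>v. v \<noteq> 0 \<and> A *v v = l *\<^sub>R v)"

definition charpoly :: "real^'n^'n \<Rightarrow> real poly" where
  "charpoly A = det (mat [:0, 1:] - (\<chi> i j. [:A $ i $ j:]))"

text \<open>Real eigenvalues, repeated according to their algebraic multiplicity. Non-real eigenvalues are
  not recorded, so the multiset has \<open>CARD('n)\<close> elements only if all eigenvalues are real.\<close>

definition eigenvalues :: "real^'n^'n \<Rightarrow> real multiset" where
  "eigenvalues A = proots (charpoly A)"

lemma poly_charpoly: "poly (charpoly A) x = det (mat x - A)"
proof -
  have "poly (of_int k) x = of_int k" for k
    by (simp add: of_int_poly)
  then show ?thesis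
    unfolding charpoly_def det_def
    by (auto simp: poly_sum poly_prod mat_def intro!: sum.cong prod.cong)
qed

lemma eigenvalue_iff_root: "eigenvalue A x \<longleftrightarrow> poly (charpoly A) x = 0"
proof -
  have "(mat x - A) *v v = x *\<^sub>R v - A *v v" for v
    by (simp add: vec_eq_iff matrix_vector_mult_def mat_def left_diff_distrib sum_subtractf
        if_distribR if_distrib[of "\<lambda>z. z * _"] cong: if_cong)
  moreover have "det (mat x - A) = 0 \<longleftrightarrow> (\<exists>v. v \<noteq> 0 \<and> (mat x - A) *v v = 0)"
    using invertible_det_nz[of "mat x - A"] matrix_left_invertible_ker[of "mat x - A"]
    by (auto simp: invertible_left_inverse)
  ultimately show ?thesis
    by (auto simp: eigenvalue_def poly_charpoly)
qed

lemma charpoly_nonzero: "charpoly A \<noteq> 0"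
proof
  assume "charpoly A = 0"
  define x where "x = onorm ((*v) A) + 1"
  have bl: "bounded_linear ((*v) A)"
    by (simp add: linear_conv_bounded_linear[symmetric])
  have "eigenvalue A x"
    by (simp add: eigenvalue_iff_root \<open>charpoly A = 0\<close>)
  then obtain v where v: "v \<noteq> 0" "A *v v = x *\<^sub>R v"
    by (auto simp: eigenvalue_def)
  have "x > 0"
    using onorm_pos_le[OF bl] by (simp add: x_def)
  then have "x * norm v \<le> onorm ((*v) A) * norm v"
    using onorm[OF bl, of v] v(2) by simp
  then show False
    using v(1) by (simp add: x_def)
qed

lemma eigenvalue_iff_mem_eigenvalues: "eigenvalue A x \<longleftrightarrow> x \<in># eigenvalues A"
  by (simp add: eigenvalues_def charpoly_nonzero eigenvalue_iff_root)


definition critical_point :: "(real^'n \<Rightarrow> real^'n) \<Rightarrow> real^'n \<Rightarrow> bool" where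
  "critical_point F p \<longleftrightarrow> F p = 0"

text \<open>The next two notions are meant for vector fields on \<open>\<real>\<^sup>3\<close> that are invariant under translation by
  \<open>(1,1,1)\<close>: the Jacobian then always has the eigenvalue 0, which is discounted once.\<close>

definition linearly_stable :: "(real^3 \<Rightarrow> real^3) \<Rightarrow> real^3 \<Rightarrow> bool" where
  "linearly_stable F p \<longleftrightarrow> critical_point F p \<and>
     (\<exists>l m. eigenvalues (jacobian F (at p)) = {#0, l, m#} \<and> l < 0 \<and> m < 0)"

definition linearly_unstable :: "(real^3 \<Rightarrow> real^3) \<Rightarrow> real^3 \<Rightarrow> bool" where
  "linearly_unstable F p \<longleftrightarrow> critical_point F p \<and>
     (\<exists>l. eigenvalue (jacobian F (at p)) l \<and> l > 0)"


definition rhs :: "real \<Rightarrow> real \<Rightarrow> real^3 \<Rightarrow> real^3" where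
  "rhs K1 K2 \<theta> = vector
     [K2 / 3 * sin (\<theta>$3 - \<theta>$1) + K1 / 3 * sin (\<theta>$2 - \<theta>$1),
      K2 / 3 * sin (\<theta>$3 - \<theta>$2) + K1 / 3 * sin (\<theta>$1 - \<theta>$2),
      K2 / 3 * sin (\<theta>$1 - \<theta>$3) + K2 / 3 * sin (\<theta>$2 - \<theta>$3)]"

definition Theta1 :: "real^3" where "Theta1 = vector [0, pi, 0]"
definition Theta2 :: "real^3" where "Theta2 = vector [0, pi, pi]"
definition Theta3 :: "real^3" where "Theta3 = vector [0, 0, 0]"
definition Theta4 :: "real^3" where "Theta4 = vector [0, 0, pi]"

text \<open>\<open>Theta5\<close> and \<open>Theta6\<close> are meaningful only if \<open>\<bar>K2 / (2 * K1)\<bar> \<le> 1\<close>, since \<^const>\<open>arccos\<close> is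
  unspecified outside \<open>[-1, 1]\<close>.\<close>

definition Theta5 :: "real \<Rightarrow> real \<Rightarrow> real^3" where
  "Theta5 K1 K2 = (let a = arccos (- (K2 / (2 * K1))) in vector [0, 2 * a, a])"

definition Theta6 :: "real \<Rightarrow> real \<Rightarrow> real^3" where
  "Theta6 K1 K2 = (let a = arccos (- (K2 / (2 * K1))) in vector [0, 2 * pi - 2 * a, 2 * pi - a])"

end

theory Submission
  imports Defs
begin

no_notation fps_nth (infixl \<open>$\<close> 75)

text \<open>The Jacobian of the right-hand side is the negative of the weighted Laplacian of a triangle with
  edge weights \<open>a\<close>, \<open>b\<close>, \<open>c\<close>. Its characteristic polynomial is
  \<open>x (x\<^sup>2 + 2 s x + 3 (a b + b c + c a))\<close> with \<open>s = a + b + c\<close>, so its eigenvalues are \<open>0\<close> and \<open>- s \<plusminus> d\<close>,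
  where \<open>d\<^sup>2 = s\<^sup>2 - 3 (a b + b c + c a)\<close>. At \<open>Theta1\<close> and \<open>Theta2\<close> we have \<open>c = - b\<close> and the two
  nontrivial eigenvalues have negative product \<open>- 3 b\<^sup>2\<close>; at the other critical points \<open>c = b\<close> and
  they are \<open>- 3 b\<close> and \<open>- (2 a + b)\<close>.\<close>

definition neg_laplacian3 :: "real \<Rightarrow> real \<Rightarrow> real \<Rightarrow> real^3^3" where
  "neg_laplacian3 a b c = vector
     [vector [- (a + b), a, b], vector [a, - (a + c), c], vector [b, c, - (b + c)]]"

text \<open>A root \<open>d\<close> of the reduced discriminant is left to the caller, who may
  choose its sign and form: a square root for opposite weights, simply \<open>a - b\<close> in the
  isosceles case.\<close>

lemma eigenvalues_neg_laplacian3: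
  fixes a b c d :: real
  assumes "d\<^sup>2 = (a + b + c)\<^sup>2 - 3 * (a * b + b * c + c * a)"
  shows "eigenvalues (neg_laplacian3 a b c) = {#0, - (a + b + c) + d, - (a + b + c) - d#}"
proof -
  let ?s = "a + b + c"
  have "poly (charpoly (neg_laplacian3 a b c)) x =
      poly ([:- 0, 1:] * [:- (- ?s + d), 1:] * [:- (- ?s - d), 1:]) x" for x
  proof -
    have "poly (charpoly (neg_laplacian3 a b c)) x =
        x * (x\<^sup>2 + 2 * ?s * x + 3 * (a * b + b * c + c * a))"
      by (simp add: poly_charpoly det_3 neg_laplacian3_def mat_def) algebra
    also have "\<dots> = x * ((x + ?s)\<^sup>2 - d\<^sup>2)"
      unfolding assms by algebra
    also have "\<dots> = poly ([:- 0, 1:] * [:- (- ?s + d), 1:] * [:- (- ?s - d), 1:]) x"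
      by simp algebra
    finally show ?thesis .
  qed
  then have "charpoly (neg_laplacian3 a b c) =
      [:- 0, 1:] * [:- (- ?s + d), 1:] * [:- (- ?s - d), 1:]"
    by (intro poly_eq_poly_eq_iff[THEN iffD1] ext)
  then show ?thesis
    unfolding eigenvalues_def
    by (simp only: proots_mult mult_eq_0_iff pCons_eq_0_iff one_neq_zero simp_thms
        proots_linear_factor) simp
qed

lemma jacobian_rhs:
  "jacobian (rhs K1 K2) (at p) =
    neg_laplacian3 (K1 / 3 * cos (p$2 - p$1)) (K2 / 3 * cos (p$3 - p$1)) (K2 / 3 * cos (p$3 - p$2))"
    (is "_ = ?A")
proof -
  \<comment> \<open>Evenness of \<open>cos\<close> is what makes the Jacobian symmetric, so that
    three weights suffice.\<close>
  have "cos (p$1 - p$2) = cos (p$2 - p$1)" "cos (p$1 - p$3) = cos (p$3 - p$1)"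
    "cos (p$2 - p$3) = cos (p$3 - p$2)"
    by (metis cos_minus minus_diff_eq)+
  note cos_sym = this
  have "(rhs K1 K2 has_derivative (*v) ?A) (at p)"
  proof (subst has_derivative_componentwise_within, safe)
    fix i :: "real^3"
    assume "i \<in> Basis"
    then obtain k where k: "i = axis k 1"
      by (auto simp: Basis_vec_def)
    have "((\<lambda>x. rhs K1 K2 x $ k) has_derivative (\<lambda>x. (?A *v x) $ k)) (at p)"
      using exhaust_3[of k]
      by (elim disjE; hypsubst; unfold rhs_def vector_3)
        (rule derivative_eq_intros bounded_linear_imp_has_derivative bounded_linear_vec_nth refl
          | simp add: fun_eq_iff neg_laplacian3_def matrix_vector_mult_def sum_3 cos_sym field_simps)+
    then show "((\<lambda>x. rhs K1 K2 x \<bullet> i) has_derivative (\<lambda>x. (?A *v x) \<bullet> i)) (at p)"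
      by (simp add: k inner_axis)
  qed
  then have "frechet_derivative (rhs K1 K2) (at p) = (*v) ?A"
    by (rule frechet_derivative_at[symmetric])
  then show ?thesis
    by (simp add: jacobian_def)
qed

lemma linearly_unstable_rhs_opposite_weights:
  assumes "critical_point (rhs K1 K2) p"
    and "K2 / 3 * cos (p$3 - p$1) = b" "K2 / 3 * cos (p$3 - p$2) = - b" "b \<noteq> 0"
  shows "linearly_unstable (rhs K1 K2) p"
proof -
  define a where "a = K1 / 3 * cos (p$2 - p$1)"
  define d where "d = sqrt (a\<^sup>2 + 3 * b\<^sup>2)"
  have "eigenvalues (jacobian (rhs K1 K2) (at p)) = {#0, - a + d, - a - d#}"
    using eigenvalues_neg_laplacian3[of d a b "- b"]
    by (simp only: jacobian_rhs assms(2,3) a_def[symmetric])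
      (simp add: d_def power2_eq_square algebra_simps)
  \<comment> \<open>As \<open>b \<noteq> 0\<close>, \<open>d\<close> exceeds the absolute value of
    \<open>a\<close>, whatever the sign of \<open>a\<close>.\<close>
  moreover have "- a + d > 0"
    using assms(4) unfolding d_def by (simp add: real_less_rsqrt)
  ultimately show ?thesis
    using assms(1) by (auto simp: linearly_unstable_def eigenvalue_iff_mem_eigenvalues)
qed

text \<open>For equal weights \<open>b = c\<close> the discriminant is the perfect square
  \<open>(a - b)\<^sup>2\<close>, so the eigenvalues are linear in the weights.\<close>

lemma eigenvalues_jacobian_rhs_isosceles:
  assumes "cos (p$3 - p$2) = cos (p$3 - p$1)"
  shows "eigenvalues (jacobian (rhs K1 K2) (at p)) =
    {#0, - (K2 * cos (p$3 - p$1)), - ((2 * K1 * cos (p$2 - p$1) + K2 * cos (p$3 - p$1)) / 3)#}"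
proof -
  define a b where "a = K1 / 3 * cos (p$2 - p$1)" and "b = K2 / 3 * cos (p$3 - p$1)"
  have "eigenvalues (jacobian (rhs K1 K2) (at p)) =
      {#0, - (a + b + b) + (a - b), - (a + b + b) - (a - b)#}"
    using eigenvalues_neg_laplacian3[of "a - b" a b b]
    by (simp only: jacobian_rhs assms a_def[symmetric] b_def[symmetric])
      (simp add: power2_eq_square algebra_simps)
  then show ?thesis
    by (simp add: a_def b_def field_simps)
qed

lemma linearly_stable_rhs_isosceles:
  assumes "critical_point (rhs K1 K2) p" "cos (p$3 - p$2) = cos (p$3 - p$1)"
    and "K2 * cos (p$3 - p$1) > 0" "2 * K1 * cos (p$2 - p$1) + K2 * cos (p$3 - p$1) > 0"
  shows "linearly_stable (rhs K1 K2) p"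
proof -
  have "- (K2 * cos (p$3 - p$1)) < 0"
    "- ((2 * K1 * cos (p$2 - p$1) + K2 * cos (p$3 - p$1)) / 3) < 0"
    using assms(3,4) by simp_all
  then show ?thesis
    unfolding linearly_stable_def
    using assms(1) eigenvalues_jacobian_rhs_isosceles[OF assms(2)] by blast
qed

lemma linearly_unstable_rhs_isosceles:
  assumes "critical_point (rhs K1 K2) p" "cos (p$3 - p$2) = cos (p$3 - p$1)"
    and "K2 * cos (p$3 - p$1) < 0 \<or> 2 * K1 * cos (p$2 - p$1) + K2 * cos (p$3 - p$1) < 0"
  shows "linearly_unstable (rhs K1 K2) p"
  using assms(1,3)
  by (auto simp: linearly_unstable_def eigenvalue_iff_mem_eigenvalues
      eigenvalues_jacobian_rhs_isosceles[OF assms(2)])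

text \<open>If \<open>\<bar>K2 / (2 * K1)\<bar> \<le> 1\<close>, both \<open>Theta5\<close> and \<open>Theta6\<close> satisfy the assumptions on \<open>p\<close>: there
  \<open>p$3 - p$1\<close> and \<open>p$3 - p$2\<close> are opposite modulo \<open>2 * pi\<close>.\<close>

context
  fixes K1 K2 :: real and p :: "real^3"
  assumes K1: "K1 \<noteq> 0"
    and cos_32: "cos (p$3 - p$2) = cos (p$3 - p$1)"
    and sin_32: "sin (p$3 - p$2) = - sin (p$3 - p$1)"
    and cos_31: "cos (p$3 - p$1) = - (K2 / (2 * K1))"
begin

text \<open>Modulo \<open>2 * pi\<close>, \<open>p$2 - p$1\<close> is twice
  \<open>p$3 - p$1\<close>. The double-angle formula and the value of the cosine turn the
  \<open>K1\<close> terms into multiples of \<open>K2\<close> that cancel the others.\<close>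

lemma critical_point_rhs_opposite: "critical_point (rhs K1 K2) p"
proof -
  have flip: "sin (p$1 - p$3) = - sin (p$3 - p$1)" "sin (p$2 - p$3) = - sin (p$3 - p$2)"
    "sin (p$1 - p$2) = - sin (p$2 - p$1)"
    by (metis sin_minus minus_diff_eq)+
  have "sin (p$2 - p$1) = 2 * sin (p$3 - p$1) * cos (p$3 - p$1)"
    using sin_diff[of "p$3 - p$1" "p$3 - p$2"] by (simp add: cos_32 sin_32)
  also have "\<dots> = - (K2 / K1) * sin (p$3 - p$1)"
    by (simp add: cos_31)
  finally show ?thesis
    using K1 by (simp add: critical_point_def rhs_def vec_eq_iff forall_3 flip sin_32)
qed

lemma cos_21_opposite: "2 * K1 * cos (p$2 - p$1) = K2\<^sup>2 / K1 - 2 * K1"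
proof -
  have "cos (p$2 - p$1) = 2 * (cos (p$3 - p$1))\<^sup>2 - 1"
    using cos_diff[of "p$3 - p$1" "p$3 - p$2"]
    by (simp add: cos_32 sin_32 cos_squared_eq power2_eq_square[symmetric])
  then show ?thesis
    using K1 by (simp add: cos_31 power2_eq_square field_simps)
qed

text \<open>The eigenvalue \<open>- K2 * cos (p$3 - p$1)\<close> equals
  \<open>K2\<^sup>2 / (2 * K1)\<close>, which has the sign of \<open>K1\<close>.\<close>

lemma linearly_unstable_rhs_opposite:
  assumes "K1 > 0" "K2 \<noteq> 0"
  shows "linearly_unstable (rhs K1 K2) p"
proof -
  have "K2 * cos (p$3 - p$1) < 0"
    using assms by (auto simp: cos_31 zero_less_divide_iff zero_less_mult_iff linorder_neq_iff)
  then show ?thesis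
    using critical_point_rhs_opposite cos_32 by (blast intro: linearly_unstable_rhs_isosceles)
qed

lemma linearly_stable_rhs_opposite:
  assumes "2 * K1 + K2 < 0" "2 * K1 - K2 < 0" "K2 \<noteq> 0"
  shows "linearly_stable (rhs K1 K2) p"
proof -
  have "K1 < 0"
    using assms by simp
  \<comment> \<open>The two assumed inequalities together say
    \<open>\<bar>K2\<bar> < - 2 * K1\<close>.\<close>
  have "K2\<^sup>2 < (2 * K1)\<^sup>2"
    using assms(1,2) by (intro power2_strict_mono) auto
  have "K2 * cos (p$3 - p$1) > 0"
    using \<open>K1 < 0\<close> assms(3)
    by (auto simp: cos_31 divide_less_0_iff zero_less_mult_iff mult_less_0_iff linorder_neq_iff)
  moreover have "2 * K1 * cos (p$2 - p$1) + K2 * cos (p$3 - p$1) = (K2\<^sup>2 - (2 * K1)\<^sup>2) / (2 * K1)"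
    unfolding cos_21_opposite cos_31 using K1 by (simp add: power2_eq_square field_simps)
  moreover have "\<dots> > 0"
    using \<open>K1 < 0\<close> \<open>K2\<^sup>2 < (2 * K1)\<^sup>2\<close> by (intro divide_neg_neg) auto
  ultimately show ?thesis
    using critical_point_rhs_opposite cos_32 by (intro linearly_stable_rhs_isosceles) auto
qed

end

text \<open>With \<open>a\<close> the arccosine, \<open>p$3 - p$1\<close> and
  \<open>p$3 - p$2\<close> are \<open>a\<close> and \<open>- a\<close> at \<open>Theta5\<close>, and
  \<open>2 * pi - a\<close> and \<open>a\<close> at \<open>Theta6\<close>. The bound lets
  \<open>cos\<close> undo \<open>arccos\<close>.\<close>

lemma
  assumes "\<bar>K2 / (2 * K1)\<bar> \<le> 1"
  shows Theta5_opposite: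
      "cos (Theta5 K1 K2 $ 3 - Theta5 K1 K2 $ 2) = cos (Theta5 K1 K2 $ 3 - Theta5 K1 K2 $ 1)"
      "sin (Theta5 K1 K2 $ 3 - Theta5 K1 K2 $ 2) = - sin (Theta5 K1 K2 $ 3 - Theta5 K1 K2 $ 1)"
      "cos (Theta5 K1 K2 $ 3 - Theta5 K1 K2 $ 1) = - (K2 / (2 * K1))"
    and Theta6_opposite:
      "cos (Theta6 K1 K2 $ 3 - Theta6 K1 K2 $ 2) = cos (Theta6 K1 K2 $ 3 - Theta6 K1 K2 $ 1)"
      "sin (Theta6 K1 K2 $ 3 - Theta6 K1 K2 $ 2) = - sin (Theta6 K1 K2 $ 3 - Theta6 K1 K2 $ 1)"
      "cos (Theta6 K1 K2 $ 3 - Theta6 K1 K2 $ 1) = - (K2 / (2 * K1))"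
proof -
  have "cos (arccos (- (K2 / (2 * K1)))) = - (K2 / (2 * K1))"
    using assms by (intro cos_arccos_abs) simp
  then show
    "cos (Theta5 K1 K2 $ 3 - Theta5 K1 K2 $ 2) = cos (Theta5 K1 K2 $ 3 - Theta5 K1 K2 $ 1)"
    "sin (Theta5 K1 K2 $ 3 - Theta5 K1 K2 $ 2) = - sin (Theta5 K1 K2 $ 3 - Theta5 K1 K2 $ 1)"
    "cos (Theta5 K1 K2 $ 3 - Theta5 K1 K2 $ 1) = - (K2 / (2 * K1))"
    "cos (Theta6 K1 K2 $ 3 - Theta6 K1 K2 $ 2) = cos (Theta6 K1 K2 $ 3 - Theta6 K1 K2 $ 1)"
    "sin (Theta6 K1 K2 $ 3 - Theta6 K1 K2 $ 2) = - sin (Theta6 K1 K2 $ 3 - Theta6 K1 K2 $ 1)"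
    "cos (Theta6 K1 K2 $ 3 - Theta6 K1 K2 $ 1) = - (K2 / (2 * K1))"
    by (simp_all add: Theta5_def Theta6_def Let_def sin_diff cos_diff)
qed

theorem proposition1:
  fixes K1 K2 :: real
  assumes "K1 \<noteq> 0" and "K2 \<noteq> 0"
  shows
    "(critical_point (rhs K1 K2) Theta1 \<and> critical_point (rhs K1 K2) Theta2 \<and>
      critical_point (rhs K1 K2) Theta3 \<and> critical_point (rhs K1 K2) Theta4 \<and>
      (\<bar>K2 / (2 * K1)\<bar> \<le> 1 \<longrightarrow>
        critical_point (rhs K1 K2) (Theta5 K1 K2) \<and>
        critical_point (rhs K1 K2) (Theta6 K1 K2)))
   \<and> (linearly_unstable (rhs K1 K2) Theta1 \<and> linearly_unstable (rhs K1 K2) Theta2)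
   \<and> (K2 > 0 \<and> 2 * K1 + K2 > 0 \<longrightarrow>
        linearly_stable (rhs K1 K2) Theta3 \<and>
        linearly_unstable (rhs K1 K2) Theta1 \<and> linearly_unstable (rhs K1 K2) Theta2 \<and>
        linearly_unstable (rhs K1 K2) Theta4 \<and>
        (\<bar>K2 / (2 * K1)\<bar> \<le> 1 \<longrightarrow>
        linearly_unstable (rhs K1 K2) (Theta5 K1 K2) \<and> linearly_unstable (rhs K1 K2) (Theta6 K1 K2)))
   \<and> (K2 < 0 \<and> 2 * K1 - K2 > 0 \<longrightarrow>
        linearly_stable (rhs K1 K2) Theta4 \<and>
        linearly_unstable (rhs K1 K2) Theta1 \<and> linearly_unstable (rhs K1 K2) Theta2 \<and>
        linearly_unstable (rhs K1 K2) Theta3 \<and>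
        (\<bar>K2 / (2 * K1)\<bar> \<le> 1 \<longrightarrow>
        linearly_unstable (rhs K1 K2) (Theta5 K1 K2) \<and> linearly_unstable (rhs K1 K2) (Theta6 K1 K2)))
   \<and> (2 * K1 + K2 < 0 \<and> 2 * K1 - K2 < 0 \<longrightarrow>
        \<bar>K2 / (2 * K1)\<bar> \<le> 1 \<and>
        linearly_stable (rhs K1 K2) (Theta5 K1 K2) \<and> linearly_stable (rhs K1 K2) (Theta6 K1 K2) \<and>
        linearly_unstable (rhs K1 K2) Theta1 \<and> linearly_unstable (rhs K1 K2) Theta2 \<and>
        linearly_unstable (rhs K1 K2) Theta3 \<and> linearly_unstable (rhs K1 K2) Theta4)"
proof -
  let ?F = "rhs K1 K2"
  have crit: "critical_point ?F Theta1" "critical_point ?F Theta2"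
    "critical_point ?F Theta3" "critical_point ?F Theta4"
    by (simp_all add: critical_point_def rhs_def vec_eq_iff forall_3
        Theta1_def Theta2_def Theta3_def Theta4_def)
  \<comment> \<open>Here \<open>b\<close> is \<open>K2 / 3\<close> at \<open>Theta1\<close> and
    \<open>- K2 / 3\<close> at \<open>Theta2\<close>.\<close>
  have unstable12: "linearly_unstable ?F Theta1" "linearly_unstable ?F Theta2"
    using crit assms(2)
    by (auto intro!: linearly_unstable_rhs_opposite_weights simp: Theta1_def Theta2_def)
  \<comment> \<open>All cosines are 1 at \<open>Theta3\<close>: the nontrivial eigenvalues are
    \<open>- K2\<close> and \<open>- (2 * K1 + K2) / 3\<close>.\<close>
  have stable3: "linearly_stable ?F Theta3" if "K2 > 0" "2 * K1 + K2 > 0"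
    using crit that by (intro linearly_stable_rhs_isosceles) (simp_all add: Theta3_def)
  have unstable3: "linearly_unstable ?F Theta3" if "K2 < 0 \<or> 2 * K1 + K2 < 0"
    using crit that by (intro linearly_unstable_rhs_isosceles) (simp_all add: Theta3_def)
  \<comment> \<open>At \<open>Theta4\<close> the cosines next to \<open>K2\<close> become -1, which
    amounts to replacing \<open>K2\<close> by \<open>- K2\<close> in the eigenvalues at
    \<open>Theta3\<close>.\<close>
  have stable4: "linearly_stable ?F Theta4" if "K2 < 0" "2 * K1 - K2 > 0"
    using crit that by (intro linearly_stable_rhs_isosceles) (simp_all add: Theta4_def)
  have unstable4: "linearly_unstable ?F Theta4" if "K2 > 0 \<or> 2 * K1 - K2 < 0"
    using crit that by (intro linearly_unstable_rhs_isosceles) (simp_all add: Theta4_def)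
  have abs_le_iff: "\<bar>K2 / (2 * K1)\<bar> \<le> 1 \<longleftrightarrow> \<bar>K2\<bar> \<le> 2 * \<bar>K1\<bar>"
    using assms(1) by (simp add: abs_mult divide_le_eq_1)
  have crit56: "critical_point ?F (Theta5 K1 K2)" "critical_point ?F (Theta6 K1 K2)"
    if "\<bar>K2 / (2 * K1)\<bar> \<le> 1"
    using critical_point_rhs_opposite[OF assms(1)] Theta5_opposite[OF that]
      Theta6_opposite[OF that] by blast+
  have unstable56: "linearly_unstable ?F (Theta5 K1 K2)" "linearly_unstable ?F (Theta6 K1 K2)"
    if "\<bar>K2 / (2 * K1)\<bar> \<le> 1" "K1 > 0"
    using linearly_unstable_rhs_opposite[OF assms(1) _ _ _ that(2) assms(2)]
      Theta5_opposite[OF that(1)] Theta6_opposite[OF that(1)] by blast+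
  have stable56: "linearly_stable ?F (Theta5 K1 K2)" "linearly_stable ?F (Theta6 K1 K2)"
    if "\<bar>K2 / (2 * K1)\<bar> \<le> 1" "2 * K1 + K2 < 0" "2 * K1 - K2 < 0"
    using linearly_stable_rhs_opposite[OF assms(1) _ _ _ that(2,3) assms(2)]
      Theta5_opposite[OF that(1)] Theta6_opposite[OF that(1)] by blast+
  \<comment> \<open>Both regimes give \<open>2 * K1 + \<bar>K2\<bar> > 0\<close>. A negative
    \<open>K1\<close> would contradict this, since existence of \<open>Theta5\<close> and
    \<open>Theta6\<close> means \<open>\<bar>K2\<bar> \<le> 2 * \<bar>K1\<bar>\<close>.\<close>
  have pos: "K1 > 0"
    if "\<bar>K2 / (2 * K1)\<bar> \<le> 1" "K2 > 0 \<and> 2 * K1 + K2 > 0 \<or> K2 < 0 \<and> 2 * K1 - K2 > 0"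
    using that abs_le_iff by arith
  \<comment> \<open>In the last regime \<open>\<bar>K2\<bar> < - 2 * K1\<close>, so
    \<open>Theta5\<close> and \<open>Theta6\<close> exist automatically.\<close>
  have le: "\<bar>K2 / (2 * K1)\<bar> \<le> 1" if "2 * K1 + K2 < 0" "2 * K1 - K2 < 0"
    using that abs_le_iff by arith
  show ?thesis
    using crit crit56 unstable12 stable3 unstable3 stable4 unstable4 unstable56 stable56 pos le
    by blast
qed

end
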